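(* Let $\Omega$ be a Hausdorff topological space with Borel $\sigma$-field $\mathfrak{B}$, let $\Theta$ be the set of all probability measures on $(\Omega,\mathfrak{B})$ equipped with the $\tau$-topology, and let $\Theta_0,\Theta_1\subset\Theta$. Let $X_1,\ldots,X_n$ be i.i.d. with law $P\in\Theta$, and consider testing $H_0: P\in\Theta_0$ versus $H_1:P\in\Theta_1$. Write $\mathrm{cl}_\tau(\Psi)$ for the closure of $\Psi\subset\Theta$ in the $\tau$-topology. Then: (i) If $\Theta_0$ and $\Theta_1$ are both relatively compact in the $\tau$-topology and $\mathrm{cl}_\tau(\Theta_0)\cap \mathrm{cl}_\tau(\Theta_1)\neq\emptyset$, then $H_0$ and $H_1$ are indistinguishable. (ii) If $\Theta_0$ or $\Theta_1$ is relatively compact in the $\tau$-topology and $\mathrm{cl}_\tau(\Theta_0)\cap \mathrm{cl}_\tau(\Theta_1)=\emptyset$, then $H_0$ and $H_1$ are distinguishable. Moreover, there exist a sequence of tests $K_n=K_n(X_1,\ldots,X_n)$, a constant $c>0$ and a constant $n_0$ such that for all $n>n_0$ $$\alpha(K_n)\le \exp\{-cn\}\quad\text{and}\quad \beta(K_n)\le\exp\{-cn\}.$$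
   Context: The $\tau$-topology on $\Theta$ is the coarsest topology for which all maps $P\mapsto P(B)$, $B\in\mathfrak{B}$, are continuous. A set $\Psi\subset\Theta$ is relatively compact in the $\tau$-topology if its $\tau$-closure in $\Theta$ is $\tau$-compact. A test based on $n$ observations is a measurable function $K_n:(\Omega^n,\mathfrak{B}^{n})\to[0,1]$, with $\mathfrak{B}^n$ the product $\sigma$-field (the value is the probability of rejecting $H_0$). Its error probabilities are $\alpha(K_n)=\sup_{P\in\Theta_0}E_P[K_n]$ and $\beta(K_n)=\sup_{P\in\Theta_1}E_P[1-K_n]$, where $E_P$ is expectation for $X_1,\ldots,X_n$ i.i.d. with law $P$. $H_0$ and $H_1$ are distinguishable if there are uniformly consistent tests: for every $0<\alpha<1$ there are tests $K_n$, $n=1,2,\ldots$, with $\alpha(K_n)<\alpha$ and $\lim_{n\to\infty}\beta(K_n)=0$. They are indistinguishable if $\alpha(K_n)+\beta(K_n)\ge 1$ for every $n$ and every test $K_n$. *)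

theory Defs
  imports "HOL-Probability.Probability"
begin



definition prob_measures :: "'a::topological_space measure set" where
  "prob_measures = space (prob_algebra borel)"

lemma prob_measures_iff: "P \<in> prob_measures \<longleftrightarrow> prob_space P \<and> sets P = sets borel"
  by (auto simp: prob_measures_def space_prob_algebra)

definition tau_topology :: "'a::topological_space measure topology" where
  "tau_topology = topology_generated_by
     {{P \<in> prob_measures. measure P B \<in> U} | B U. B \<in> sets borel \<and> open U}"

text \<open>The next three facts say that this is the coarsest topology on the set of probability
  measures for which all evaluations are continuous.\<close>

lemma topspace_tau_topology: "topspace tau_topology = prob_measures"
proof -
  have "prob_measures \<in> {{P \<in> prob_measures. measure P B \<in> U} | B U. B \<in> sets borel \<and> open U}"
    by (rule CollectI, rule exI[of _ UNIV], rule exI[of _ UNIV]) auto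
  then show ?thesis
    unfolding tau_topology_def topology_generated_by_topspace by blast
qed

lemma continuous_map_tau_topology:
  assumes "B \<in> sets borel"
  shows "continuous_map tau_topology euclideanreal (\<lambda>P. measure P B)"
  unfolding continuous_map_def topspace_tau_topology
proof (intro conjI allI impI)
  fix U :: "real set" assume "openin euclideanreal U"
  then show "openin tau_topology {P \<in> prob_measures. measure P B \<in> U}"
    unfolding tau_topology_def using assms
    by (intro topology_generated_by_Basis) auto
qed auto

lemma tau_topology_coarsest:
  assumes "topspace T = prob_measures"
    and "\<And>B. B \<in> sets borel \<Longrightarrow> continuous_map T euclideanreal (\<lambda>P. measure P B)"
    and "openin tau_topology V"
  shows "openin T V"
proof -
  have "generate_topology_on
     {{P \<in> prob_measures. measure P B \<in> U} | B U. B \<in> sets borel \<and> open U} V"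
    using assms(3) unfolding tau_topology_def by (simp add: openin_topology_generated_by_iff)
  then show ?thesis
  proof induction
    case (Basis s)
    then obtain B U where "s = {P \<in> prob_measures. measure P B \<in> U}" "B \<in> sets borel" "open U"
      by blast
    then show ?case
      using assms(2)[of B] by (auto simp: continuous_map_def assms(1))
  qed auto
qed

definition tau_relatively_compact :: "'a::topological_space measure set \<Rightarrow> bool" where
  "tau_relatively_compact \<Psi> \<longleftrightarrow> compactin tau_topology (tau_topology closure_of \<Psi>)"

definition is_test :: "nat \<Rightarrow> ((nat \<Rightarrow> 'a::topological_space) \<Rightarrow> real) \<Rightarrow> bool" where
  "is_test n K \<longleftrightarrow> K \<in> borel_measurable (Pi\<^sub>M {..<n} (\<lambda>_. borel)) \<and>
     (\<forall>x \<in> space (Pi\<^sub>M {..<n} (\<lambda>_. borel :: 'a measure)). 0 \<le> K x \<and> K x \<le> 1)"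

text \<open>The law of \<open>n\<close> i.i.d. observations with law \<open>P\<close> is the \<open>n\<close>-fold product of \<open>P\<close>.\<close>

definition expect :: "nat \<Rightarrow> 'a measure \<Rightarrow> ((nat \<Rightarrow> 'a) \<Rightarrow> real) \<Rightarrow> real" where
  "expect n P f = (\<integral>x. f x \<partial>(Pi\<^sub>M {..<n} (\<lambda>_. P)))"

text \<open>The suprema are taken in \<^typ>\<open>ennreal\<close>, so that the supremum over an empty hypothesis is \<open>0\<close>;
  on \<^typ>\<open>real\<close> it would be unspecified.\<close>

definition error_alpha ::
    "'a measure set \<Rightarrow> nat \<Rightarrow> ((nat \<Rightarrow> 'a) \<Rightarrow> real) \<Rightarrow> ennreal" where
  "error_alpha \<Theta>0 n K = (SUP P\<in>\<Theta>0. ennreal (expect n P K))"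

definition error_beta ::
    "'a measure set \<Rightarrow> nat \<Rightarrow> ((nat \<Rightarrow> 'a) \<Rightarrow> real) \<Rightarrow> ennreal" where
  "error_beta \<Theta>1 n K = (SUP P\<in>\<Theta>1. ennreal (expect n P (\<lambda>x. 1 - K x)))"

definition distinguishable ::
    "'a::topological_space measure set \<Rightarrow> 'a measure set \<Rightarrow> bool" where
  "distinguishable \<Theta>0 \<Theta>1 \<longleftrightarrow>
     (\<forall>\<alpha>::real. 0 < \<alpha> \<and> \<alpha> < 1 \<longrightarrow>
       (\<exists>K. (\<forall>n\<ge>1. is_test n (K n) \<and> error_alpha \<Theta>0 n (K n) < ennreal \<alpha>) \<and>
            (\<lambda>n. error_beta \<Theta>1 n (K n)) \<longlonglongrightarrow> 0))"

definition indistinguishable ::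
    "'a::topological_space measure set \<Rightarrow> 'a measure set \<Rightarrow> bool" where
  "indistinguishable \<Theta>0 \<Theta>1 \<longleftrightarrow>
     (\<forall>n\<ge>1. \<forall>K. is_test n K \<longrightarrow> error_alpha \<Theta>0 n K + error_beta \<Theta>1 n K \<ge> 1)"

end

theory Submission
  imports Defs
begin

text \<open>
  If a law \<open>R\<close> is a limit of both hypotheses, no test can do better than guessing, provided that the
  power function \<open>P \<mapsto> E\<^sub>P[K]\<close> of every test \<open>K\<close> is continuous. For one observation the
  \<open>\<tau>\<close>-topology makes it so by definition. For \<open>n\<close> observations \<open>P \<mapsto> P\<^sup>n\<close> need not be continuous
  on all probability measures, but it is continuous on compact sets \<open>C\<close>, as
  \<open>continuous_map_measure_PiM\<close> shows. What makes this work is that the laws in \<open>C\<close> are uniformly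
  countably additive: along a decreasing sequence of events with empty intersection the
  probabilities tend to zero uniformly on \<open>C\<close>. For events in one observation this is Dini's theorem,
  and \<open>tau_compact_PiM_uniform_vanishing\<close> carries it over to \<open>n\<close> observations by cutting along one
  observation at a time.

  If the closures are disjoint and one of them is compact, then finitely many events and some
  \<open>\<delta> > 0\<close> separate the hypotheses: any law of one and any law of the other differ by at least \<open>\<delta>\<close> on
  one of these events (\<open>finitely_many_events_separate\<close>). It then suffices to compare the empirical
  frequencies of these events with the probabilities that the null hypothesis allows. By Hoeffding's
  inequality the frequencies come within \<open>\<delta> / 2\<close> of the true probabilities except on an event of
  exponentially small probability, and this bound is uniform over all laws
  (\<open>exponentially_consistent_tests\<close>).
\<close>

section \<open>Product laws and tests\<close>

lemma sets_PiM_prob_measures: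
  assumes "P \<in> prob_measures"
  shows "sets (Pi\<^sub>M I (\<lambda>_. P)) = sets (Pi\<^sub>M I (\<lambda>_. borel))"
  using assms by (intro sets_PiM_cong) (auto simp: prob_measures_iff)

lemma space_PiM_prob_measures:
  assumes "P \<in> prob_measures"
  shows "space (Pi\<^sub>M I (\<lambda>_. P)) = space (Pi\<^sub>M I (\<lambda>_. borel))"
  using sets_eq_imp_space_eq[OF sets_PiM_prob_measures[OF assms]] .

lemma prob_space_PiM_prob_measures:
  assumes "P \<in> prob_measures"
  shows "prob_space (Pi\<^sub>M I (\<lambda>_. P))"
  using assms by (intro prob_space_PiM) (auto simp: prob_measures_iff)

text \<open>
  Tonelli for the product of \<open>n + 1\<close> copies of \<open>P\<close>, with the last observation integrated outermost.
  The sections are stated over the product of \<open>borel\<close>, so that they are the same sets for every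
  \<open>P\<close>; this is what allows several laws to be compared on one section.
\<close>

lemma emeasure_PiM_Suc_sections:
  fixes P :: "'a::topological_space measure" and n :: nat
  assumes P: "P \<in> prob_measures"
    and E: "E \<in> sets (Pi\<^sub>M {..<Suc n} (\<lambda>_. borel))"
  defines "S y \<equiv> (\<lambda>x. x(n := y)) -` E \<inter> space (Pi\<^sub>M {..<n} (\<lambda>_. borel :: 'a measure))"
  shows "S y \<in> sets (Pi\<^sub>M {..<n} (\<lambda>_. borel))"
    and "(\<lambda>y. emeasure (Pi\<^sub>M {..<n} (\<lambda>_. P)) (S y)) \<in> borel_measurable borel"
    and "emeasure (Pi\<^sub>M {..<Suc n} (\<lambda>_. P)) E = (\<integral>\<^sup>+y. emeasure (Pi\<^sub>M {..<n} (\<lambda>_. P)) (S y) \<partial>P)"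
proof -
  interpret prob_space P using P by (simp add: prob_measures_iff)
  interpret product_sigma_finite "\<lambda>_::nat. P" ..
  interpret PI: prob_space "Pi\<^sub>M {..<n} (\<lambda>_. P)" by (rule prob_space_PiM_prob_measures[OF P])
  have E' [measurable]: "E \<in> sets (Pi\<^sub>M (insert n {..<n}) (\<lambda>_. borel))"
    using E by (simp add: lessThan_Suc)
  have [measurable_cong]: "sets P = sets borel" using P by (simp add: prob_measures_iff)
  show S: "S y \<in> sets (Pi\<^sub>M {..<n} (\<lambda>_. borel))" for y
  proof -
    have "(\<lambda>x. x(n := y)) \<in> measurable (Pi\<^sub>M {..<n} (\<lambda>_. borel :: 'a measure)) (Pi\<^sub>M (insert n {..<n}) (\<lambda>_. borel))"
      by measurable
    from measurable_sets[OF this E'] show ?thesis by (simp add: S_def)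
  qed
  have sec: "(\<integral>\<^sup>+x. indicator E (x(n := y)) \<partial>(Pi\<^sub>M {..<n} (\<lambda>_. P))) = emeasure (Pi\<^sub>M {..<n} (\<lambda>_. P)) (S y)" for y
  proof -
    have "(\<integral>\<^sup>+x. indicator E (x(n := y)) \<partial>(Pi\<^sub>M {..<n} (\<lambda>_. P))) = (\<integral>\<^sup>+x. indicator (S y) x \<partial>(Pi\<^sub>M {..<n} (\<lambda>_. P)))"
      by (intro nn_integral_cong) (auto simp: S_def space_PiM_prob_measures[OF P] indicator_def)
    then show ?thesis using S[of y] by (simp add: sets_PiM_prob_measures[OF P])
  qed
  have "(\<lambda>y. \<integral>\<^sup>+x. indicator E (x(n := y)) \<partial>(Pi\<^sub>M {..<n} (\<lambda>_. P))) \<in> borel_measurable borel"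
    by measurable
  then show "(\<lambda>y. emeasure (Pi\<^sub>M {..<n} (\<lambda>_. P)) (S y)) \<in> borel_measurable borel"
    by (simp add: sec)
  have "E \<in> sets (Pi\<^sub>M (insert n {..<n}) (\<lambda>_. P))" by measurable
  then have "emeasure (Pi\<^sub>M (insert n {..<n}) (\<lambda>_. P)) E = (\<integral>\<^sup>+z. indicator E z \<partial>(Pi\<^sub>M (insert n {..<n}) (\<lambda>_. P)))"
    by simp
  also have "\<dots> = (\<integral>\<^sup>+y. \<integral>\<^sup>+x. indicator E (x(n := y)) \<partial>(Pi\<^sub>M {..<n} (\<lambda>_. P)) \<partial>P)"
    by (rule product_nn_integral_insert_rev) auto
  finally show "emeasure (Pi\<^sub>M {..<Suc n} (\<lambda>_. P)) E = (\<integral>\<^sup>+y. emeasure (Pi\<^sub>M {..<n} (\<lambda>_. P)) (S y) \<partial>P)"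
    by (simp add: sec lessThan_Suc)
qed

lemma integrable_test:
  assumes P: "P \<in> prob_measures" and K: "is_test n K"
  shows "integrable (Pi\<^sub>M {..<n} (\<lambda>_. P)) K"
proof -
  interpret PI: prob_space "Pi\<^sub>M {..<n} (\<lambda>_. P)" by (rule prob_space_PiM_prob_measures[OF P])
  have "K \<in> borel_measurable (Pi\<^sub>M {..<n} (\<lambda>_. P))"
    using K by (simp add: is_test_def measurable_cong_sets[OF sets_PiM_prob_measures[OF P] refl])
  then show ?thesis
    using K by (intro PI.integrable_const_bound[where B = 1] AE_I2)
               (auto simp: is_test_def space_PiM_prob_measures[OF P])
qed

lemma is_test_complement: "is_test n K \<Longrightarrow> is_test n (\<lambda>x. 1 - K x)"
  by (auto simp: is_test_def)

lemma expect_nonneg: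
  assumes "P \<in> prob_measures" "is_test n K"
  shows "0 \<le> expect n P K"
  using assms(2) unfolding expect_def
  by (intro integral_nonneg_AE AE_I2) (auto simp: is_test_def space_PiM_prob_measures[OF assms(1)])

lemma expect_complement:
  assumes "P \<in> prob_measures" "is_test n K"
  shows "expect n P (\<lambda>x. 1 - K x) = 1 - expect n P K"
proof -
  interpret PI: prob_space "Pi\<^sub>M {..<n} (\<lambda>_. P)" by (rule prob_space_PiM_prob_measures[OF assms(1)])
  show ?thesis
    using integrable_test[OF assms] by (simp add: expect_def PI.prob_space)
qed

lemma expect_le_measure:
  assumes P: "P \<in> prob_measures" and K: "is_test n K" and A: "A \<in> sets (Pi\<^sub>M {..<n} (\<lambda>_. borel))"
    and KA: "\<And>x. x \<in> space (Pi\<^sub>M {..<n} (\<lambda>_. borel)) \<Longrightarrow> x \<notin> A \<Longrightarrow> K x = 0"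
  shows "expect n P K \<le> measure (Pi\<^sub>M {..<n} (\<lambda>_. P)) A"
proof -
  interpret PI: prob_space "Pi\<^sub>M {..<n} (\<lambda>_. P)" by (rule prob_space_PiM_prob_measures[OF P])
  have A': "A \<in> PI.events" using A by (simp add: sets_PiM_prob_measures[OF P])
  have "expect n P K \<le> PI.expectation (indicator A)"
    unfolding expect_def
  proof (rule integral_mono[OF integrable_test[OF P K]])
    show "integrable (Pi\<^sub>M {..<n} (\<lambda>_. P)) (indicator A :: _ \<Rightarrow> real)"
      using A' by (intro integrable_real_indicator) (auto simp: PI.emeasure_eq_measure)
    fix x assume "x \<in> space (Pi\<^sub>M {..<n} (\<lambda>_. P))"
    then have "x \<in> space (Pi\<^sub>M {..<n} (\<lambda>_. borel))" by (simp add: space_PiM_prob_measures[OF P])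
    then show "K x \<le> indicator A x"
      using K KA[of x] by (auto simp: is_test_def indicator_def)
  qed
  with A' show ?thesis by simp
qed

lemma error_beta_eq_error_alpha: "error_beta \<Theta> n K = error_alpha \<Theta> n (\<lambda>x. 1 - K x)"
  by (simp add: error_alpha_def error_beta_def)

section \<open>Continuity of product laws on compact sets\<close>

text \<open>
  Dini's argument: for a decreasing sequence of events with empty intersection the sets
  \<open>{P. P (B k) < \<epsilon>}\<close> are \<open>\<tau>\<close>-open, increase with \<open>k\<close>, and exhaust \<open>C\<close>.
\<close>

lemma tau_compact_uniform_vanishing:
  assumes C: "compactin tau_topology C"
    and B: "range B \<subseteq> sets borel" "decseq B" "(\<Inter>k. B k) = {}" and "\<epsilon> > 0"
  shows "\<exists>k. \<forall>P\<in>C. measure P (B k) < \<epsilon>"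
proof -
  define U where "U k = {P \<in> prob_measures. measure P (B k) \<in> {..<\<epsilon>}}" for k
  have C_prob: "C \<subseteq> prob_measures"
    using compactin_subset_topspace[OF C] by (simp add: topspace_tau_topology)
  have "openin tau_topology (U k)" for k
    using openin_continuous_map_preimage[OF continuous_map_tau_topology[of "B k"], of "{..<\<epsilon>}"] B(1)
    by (auto simp: U_def topspace_tau_topology)
  moreover have "C \<subseteq> \<Union>(range U)"
  proof
    fix P assume "P \<in> C"
    then have P: "P \<in> prob_measures" "sets P = sets borel"
      using C_prob by (auto simp: prob_measures_iff)
    interpret prob_space P using P by (simp add: prob_measures_iff)
    have "(\<lambda>k. measure P (B k)) \<longlonglongrightarrow> measure P (\<Inter>k. B k)"
      by (rule finite_Lim_measure_decseq) (use B P in auto)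
    then have "eventually (\<lambda>k. measure P (B k) < \<epsilon>) sequentially"
      using \<open>\<epsilon> > 0\<close> by (simp add: B(3) order_tendsto_iff)
    then show "P \<in> \<Union>(range U)"
      using P by (auto simp: U_def eventually_sequentially)
  qed
  ultimately obtain \<F> where "finite \<F>" "\<F> \<subseteq> range U" "C \<subseteq> \<Union>\<F>"
    using compactinD[OF C, of "range U"] by blast
  then obtain I where I: "finite I" "C \<subseteq> \<Union>(U ` I)"
    by (metis finite_subset_image)
  have "measure P (B (Max I)) < \<epsilon>" if "P \<in> C" for P
  proof -
    from I that obtain k where k: "k \<in> I" "P \<in> U k" by blast
    then have P: "P \<in> prob_measures" "sets P = sets borel" "measure P (B k) < \<epsilon>"
      by (auto simp: U_def prob_measures_iff)
    interpret prob_space P using P by (simp add: prob_measures_iff)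
    have "measure P (B (Max I)) \<le> measure P (B k)"
      using B(1) P(2) decseqD[OF B(2) Max_ge[OF I(1) k(1)]] by (intro finite_measure_mono) auto
    with P(3) show ?thesis by simp
  qed
  then show ?thesis by blast
qed

text \<open>
  The same uniformity for the \<open>n\<close>-fold products. Dini's argument is not available here, because the
  continuity of \<open>P \<mapsto> P\<^sup>n(E)\<close> is only derived afterwards, from this lemma. Instead the number of
  observations is increased one at a time by cutting \<open>E k\<close> along the last observation \<open>y\<close>. By
  induction, for each \<open>y\<close> the sections have small probability under all laws in \<open>C\<close> from some
  index on, so the sets \<open>A k\<close> of those \<open>y\<close> whose section at \<open>k\<close> is still large decrease to the
  empty set, and Dini's argument applies to them.

  The set \<open>A k\<close> has to be measurable, which a supremum over all of \<open>C\<close> would not guarantee.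
  Arguing by contradiction leaves only a sequence \<open>Q\<close> of laws to consider, one violating the bound
  for each \<open>k\<close>, and a countable union is harmless.
\<close>

lemma tau_compact_PiM_uniform_vanishing:
  fixes C :: "'a::topological_space measure set" and n :: nat
  assumes C: "compactin tau_topology C"
    and "range E \<subseteq> sets (Pi\<^sub>M {..<n} (\<lambda>_. borel))" "decseq E" "(\<Inter>k. E k) = {}" "\<epsilon> > 0"
  shows "\<exists>k. \<forall>P\<in>C. measure (Pi\<^sub>M {..<n} (\<lambda>_. P)) (E k) < \<epsilon>"
  using assms(2-)
proof (induction n arbitrary: E \<epsilon>)
  case 0
  \<comment> \<open>The empty product has a single point, which some \<open>E k\<close> must miss.\<close>
  then obtain k where k: "(\<lambda>_. undefined) \<notin> E k" by blast
  have "E k \<subseteq> space (Pi\<^sub>M {..<0::nat} (\<lambda>_. borel :: 'a measure))"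
    using 0(1) by (intro sets.sets_into_space) blast
  with k have "E k = {}" by (auto simp: space_PiM)
  with 0(4) show ?case by (metis measure_empty)
next
  case (Suc n)
  define S where "S E y = (\<lambda>x. x(n := y)) -` E \<inter> space (Pi\<^sub>M {..<n} (\<lambda>_. borel :: 'a measure))"
    for E and y :: 'a
  have C_prob: "C \<subseteq> prob_measures"
    using compactin_subset_topspace[OF C] by (simp add: topspace_tau_topology)
  have E: "E k \<in> sets (Pi\<^sub>M {..<Suc n} (\<lambda>_. borel))" for k
    using Suc.prems(1) by blast
  show ?case
  proof (rule ccontr)
    assume "\<not> ?thesis"
    then have "\<forall>k. \<exists>P\<in>C. \<epsilon> \<le> measure (Pi\<^sub>M {..<Suc n} (\<lambda>_. P)) (E k)"
      by (auto simp: not_less)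
    then obtain Q where Q: "Q k \<in> C" and Q_ge: "\<epsilon> \<le> measure (Pi\<^sub>M {..<Suc n} (\<lambda>_. Q k)) (E k)" for k
      by metis
    have Qp: "Q k \<in> prob_measures" for k using Q C_prob by blast
    \<comment> \<open>The probability, under \<open>Q j\<close>, of the section of \<open>E k\<close> at \<open>y\<close>.\<close>
    let ?g = "\<lambda>j k y. emeasure (Pi\<^sub>M {..<n} (\<lambda>_. Q j)) (S (E k) y)"
    define A where "A k = {y. \<exists>j. ennreal (\<epsilon>/2) < ?g j k y}" for k
    have g [measurable]: "?g j k \<in> borel_measurable borel" for j k
      unfolding S_def by (rule emeasure_PiM_Suc_sections(2)[OF Qp E])
    have S_sets: "S (E k) y \<in> sets (Pi\<^sub>M {..<n} (\<lambda>_. borel))" for k y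
      unfolding S_def by (rule emeasure_PiM_Suc_sections(1)[OF Qp E])
    have S_dec: "S (E l) y \<subseteq> S (E k) y" if "k \<le> l" for k l y
      using decseqD[OF Suc.prems(2) that] by (auto simp: S_def)
    have A_sets: "A k \<in> sets borel" for k
    proof -
      have "{y \<in> space borel. \<exists>j. ennreal (\<epsilon>/2) < ?g j k y} \<in> sets borel" by measurable
      then show ?thesis by (simp add: A_def)
    qed
    have "\<exists>k. \<forall>P\<in>C. measure P (A k) < \<epsilon>/2"
    proof (rule tau_compact_uniform_vanishing[OF C])
      show "range A \<subseteq> sets borel" using A_sets by blast
      show "decseq A"
      proof (rule decseq_SucI, rule subsetI)
        fix k y assume "y \<in> A (Suc k)"
        then obtain j where "ennreal (\<epsilon>/2) < ?g j (Suc k) y" by (auto simp: A_def)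
        also have "\<dots> \<le> ?g j k y"
          using S_sets by (intro emeasure_mono S_dec) (auto simp: sets_PiM_prob_measures[OF Qp])
        finally show "y \<in> A k" by (auto simp: A_def)
      qed
      have "\<exists>k. y \<notin> A k" for y
      proof -
        have "\<exists>k. \<forall>P\<in>C. measure (Pi\<^sub>M {..<n} (\<lambda>_. P)) (S (E k) y) < \<epsilon>/2"
        proof (rule Suc.IH)
          show "range (\<lambda>k. S (E k) y) \<subseteq> sets (Pi\<^sub>M {..<n} (\<lambda>_. borel))" using S_sets by blast
          show "decseq (\<lambda>k. S (E k) y)" by (intro monotoneI S_dec)
          show "(\<Inter>k. S (E k) y) = {}" using Suc.prems(3) by (auto simp: S_def)
        qed (use Suc.prems in simp)
        then obtain k where k: "measure (Pi\<^sub>M {..<n} (\<lambda>_. P)) (S (E k) y) < \<epsilon>/2" if "P \<in> C" for P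
          by blast
        have "?g j k y \<le> ennreal (\<epsilon>/2)" for j
        proof -
          interpret PI: prob_space "Pi\<^sub>M {..<n} (\<lambda>_. Q j)"
            by (rule prob_space_PiM_prob_measures[OF Qp])
          show ?thesis using k[OF Q[of j]] by (simp add: PI.emeasure_eq_measure ennreal_leI)
        qed
        then show ?thesis by (auto simp: A_def not_less)
      qed
      then show "(\<Inter>k. A k) = {}" by blast
    qed (use Suc.prems in simp)
    then obtain k where k: "measure (Q k) (A k) < \<epsilon>/2" using Q by blast
    interpret prob_space "Q k" using Qp[of k] by (simp add: prob_measures_iff)
    interpret PI: prob_space "Pi\<^sub>M {..<n} (\<lambda>_. Q k)" by (rule prob_space_PiM_prob_measures[OF Qp])
    interpret PS: prob_space "Pi\<^sub>M {..<Suc n} (\<lambda>_. Q k)" by (rule prob_space_PiM_prob_measures[OF Qp])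
    have Qs [measurable_cong]: "sets (Q k) = sets borel" using Qp[of k] by (simp add: prob_measures_iff)
    have "emeasure (Pi\<^sub>M {..<Suc n} (\<lambda>_. Q k)) (E k) = (\<integral>\<^sup>+y. ?g k k y \<partial>Q k)"
      unfolding S_def by (rule emeasure_PiM_Suc_sections(3)[OF Qp E])
    also have "\<dots> \<le> (\<integral>\<^sup>+y. indicator (A k) y + ennreal (\<epsilon>/2) \<partial>Q k)"
    proof (rule nn_integral_mono)
      fix y
      show "?g k k y \<le> indicator (A k) y + ennreal (\<epsilon>/2)"
      proof (cases "y \<in> A k")
        case True
        then show ?thesis using PI.emeasure_le_1[of "S (E k) y"]
          by (simp add: add_increasing2)
      next
        case False
        then show ?thesis by (auto simp: A_def not_less)
      qed
    qed
    also have "\<dots> = emeasure (Q k) (A k) + ennreal (\<epsilon>/2)"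
      using A_sets[of k] Qs by (simp add: nn_integral_add emeasure_space_1)
    also have "\<dots> = ennreal (measure (Q k) (A k) + \<epsilon>/2)"
      using Suc.prems(4) by (simp add: emeasure_eq_measure)
    finally have "measure (Pi\<^sub>M {..<Suc n} (\<lambda>_. Q k)) (E k) \<le> measure (Q k) (A k) + \<epsilon>/2"
      using Suc.prems(4) by (simp add: PS.emeasure_eq_measure del: ennreal_plus)
    with k Q_ge[of k] show False by simp
  qed
qed

text \<open>
  On rectangles \<open>P \<mapsto> P\<^sup>n(E)\<close> is a product of evaluations. A disjoint union passes to the limit
  because its tails decrease to the empty set, hence have small probability uniformly on \<open>C\<close>, and
  uniform limits of continuous functions are continuous. The \<open>\<pi>\<close>-\<open>\<lambda>\<close> theorem reaches all
  measurable sets. Compactness of \<open>C\<close> enters through this uniformity only.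
\<close>

lemma continuous_map_measure_PiM:
  fixes C :: "'a::topological_space measure set" and n :: nat
  assumes C: "compactin tau_topology C" and "E \<in> sets (Pi\<^sub>M {..<n} (\<lambda>_. borel))"
  shows "continuous_map (subtopology tau_topology C) euclideanreal
           (\<lambda>P. measure (Pi\<^sub>M {..<n} (\<lambda>_. P)) E)"
proof -
  let ?M = "Pi\<^sub>M {..<n} (\<lambda>_. borel :: 'a measure)"
  let ?T = "subtopology tau_topology C"
  have C_prob: "C \<subseteq> prob_measures"
    using compactin_subset_topspace[OF C] by (simp add: topspace_tau_topology)
  then have T: "topspace ?T = C"
    by (auto simp: topspace_tau_topology)
  have M: "sets ?M = sigma_sets (space ?M) (prod_algebra {..<n} (\<lambda>_. borel))"
    by (simp only: sets_PiM space_PiM)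
  then have E: "E \<in> sigma_sets (space ?M) (prod_algebra {..<n} (\<lambda>_. borel))"
    using assms(2) by blast
  have "prod_algebra {..<n} (\<lambda>_. borel :: 'a measure) \<subseteq> Pow (space ?M)"
    using prod_algebra_sets_into_space[of "{..<n}" "\<lambda>_. borel :: 'a measure"] by (simp add: space_PiM)
  from Int_stable_prod_algebra this E show ?thesis
  proof (induction rule: sigma_sets_induct_disjoint)
    case (basic A)
    then obtain X where X: "A = (\<Pi>\<^sub>E i\<in>{..<n}. X i)" "\<And>i. i < n \<Longrightarrow> X i \<in> sets borel"
      by (subst (asm) prod_algebra_eq_finite) auto
    have "continuous_map ?T euclideanreal (\<lambda>P. \<Prod>i<n. measure P (X i))"
      by (intro continuous_map_prod continuous_map_from_subtopology continuous_map_tau_topology)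
         (auto simp: X)
    moreover have "(\<Prod>i<n. measure P (X i)) = measure (Pi\<^sub>M {..<n} (\<lambda>_. P)) A" if "P \<in> topspace ?T" for P
    proof -
      have Pp: "prob_space P" "sets P = sets borel"
        using that C_prob by (auto simp: T prob_measures_iff)
      interpret finite_product_prob_space "\<lambda>_. P" "{..<n}"
        using Pp(1) by (auto simp: finite_product_prob_space_def product_prob_space_def
            product_prob_space_axioms_def product_sigma_finite_def finite_product_sigma_finite_def
            finite_product_sigma_finite_axioms_def prob_space_imp_sigma_finite)
      show ?thesis unfolding X(1) by (rule finite_measure_PiM_emb[symmetric]) (simp add: X(2) Pp(2))
    qed
    ultimately show ?case by (rule continuous_map_eq)
  next
    case empty
    then show ?case by simp
  next
    case (compl A)
    have A: "A \<in> sets ?M" using compl(1) by (simp only: M)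
    have "continuous_map ?T euclideanreal (\<lambda>P. 1 - measure (Pi\<^sub>M {..<n} (\<lambda>_. P)) A)"
      using compl(2) by (intro continuous_intros)
    moreover have "1 - measure (Pi\<^sub>M {..<n} (\<lambda>_. P)) A = measure (Pi\<^sub>M {..<n} (\<lambda>_. P)) (space ?M - A)"
      if "P \<in> topspace ?T" for P
    proof -
      have P: "P \<in> prob_measures" using that C_prob by (auto simp: T)
      interpret PI: prob_space "Pi\<^sub>M {..<n} (\<lambda>_. P)" by (rule prob_space_PiM_prob_measures[OF P])
      show ?thesis
        using A PI.prob_compl[of A] by (simp add: space_PiM_prob_measures[OF P] sets_PiM_prob_measures[OF P])
    qed
    ultimately show ?case by (rule continuous_map_eq)
  next
    case (union A)
    have A: "A i \<in> sets ?M" for i using union(2) unfolding M by blast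
    let ?tail = "\<lambda>k. \<Union>i\<in>{k..}. A i"
    have "(\<Inter>k. ?tail k) = {}"
    proof (rule ccontr)
      assume "(\<Inter>k. ?tail k) \<noteq> {}"
      then obtain x where "x \<in> (\<Inter>k. ?tail k)" by blast
      then have x: "\<exists>i\<ge>k. x \<in> A i" for k by (force dest: INT_D[of _ _ _ k])
      then obtain i where "x \<in> A i" by blast
      moreover obtain j where "j \<ge> Suc i" "x \<in> A j" using x[of "Suc i"] by blast
      moreover from \<open>j \<ge> Suc i\<close> have "A i \<inter> A j = {}"
        using union(1) by (simp add: disjoint_family_on_def)
      ultimately show False by blast
    qed
    then have tail: "\<exists>k. \<forall>P\<in>C. measure (Pi\<^sub>M {..<n} (\<lambda>_. P)) (?tail k) < \<epsilon>" if "\<epsilon> > 0" for \<epsilon>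
      by (intro tau_compact_PiM_uniform_vanishing[OF C] that)
         (use A in \<open>force simp: decseq_def\<close>)+
    show ?case
      unfolding mtopology_is_euclidean[symmetric]
    proof (rule Met_TC.continuous_map_uniform_limit_alt)
      show "\<forall>\<^sub>F k in sequentially. continuous_map ?T Met_TC.mtopology (\<lambda>P. \<Sum>i<k. measure (Pi\<^sub>M {..<n} (\<lambda>_. P)) (A i))"
        using union(3) by (auto intro!: always_eventually continuous_map_sum)
      fix \<epsilon> :: real assume "\<epsilon> > 0"
      then obtain k where k: "\<forall>P\<in>C. measure (Pi\<^sub>M {..<n} (\<lambda>_. P)) (?tail k) < \<epsilon>" using tail by blast
      have "dist (\<Sum>i<l. measure (Pi\<^sub>M {..<n} (\<lambda>_. P)) (A i)) (measure (Pi\<^sub>M {..<n} (\<lambda>_. P)) (\<Union>i. A i)) < \<epsilon>"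
        if "l \<ge> k" "P \<in> C" for l P
      proof -
        have P: "P \<in> prob_measures" using that C_prob by auto
        interpret PI: prob_space "Pi\<^sub>M {..<n} (\<lambda>_. P)" by (rule prob_space_PiM_prob_measures[OF P])
        have A': "A i \<in> sets (Pi\<^sub>M {..<n} (\<lambda>_. P))" for i
          using A by (simp add: sets_PiM_prob_measures[OF P])
        have "{..<l} \<union> {l..} = UNIV" by auto
        then have "(\<Union>i. A i) = (\<Union>i<l. A i) \<union> ?tail l"
          by (metis UN_Un)
        moreover have "(\<Union>i<l. A i) \<inter> ?tail l = {}"
        proof -
          have "A i \<inter> A j = {}" if "i < l" "l \<le> j" for i j
            using union(1) that by (simp add: disjoint_family_on_def)
          then show ?thesis by blast
        qed
        ultimately have "PI.prob (\<Union>i. A i) = PI.prob (\<Union>i<l. A i) + PI.prob (?tail l)"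
          using A' by (simp add: PI.finite_measure_Union)
        also have "PI.prob (\<Union>i<l. A i) = (\<Sum>i<l. PI.prob (A i))"
          using union(1) A' by (intro PI.finite_measure_finite_Union)
            (auto simp: disjoint_family_on_def)
        finally have "dist (\<Sum>i<l. PI.prob (A i)) (PI.prob (\<Union>i. A i)) = PI.prob (?tail l)"
          by (simp add: dist_real_def)
        also have "\<dots> \<le> PI.prob (?tail k)"
          using that A' by (intro PI.finite_measure_mono UN_mono) auto
        also have "\<dots> < \<epsilon>" using k that by blast
        finally show ?thesis .
      qed
      then show "\<forall>\<^sub>F l in sequentially. \<forall>P\<in>topspace ?T.
          dist (\<Sum>i<l. measure (Pi\<^sub>M {..<n} (\<lambda>_. P)) (A i)) (measure (Pi\<^sub>M {..<n} (\<lambda>_. P)) (\<Union>i. A i)) < \<epsilon>"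
        unfolding T eventually_sequentially by blast
    qed auto
  qed
qed

text \<open>
  Counting the levels \<open>j / m\<close> below \<open>t\<close> gives \<open>\<lfloor>m t\<rfloor>\<close>. Applied to the values of a test, this
  approximates the test uniformly by an average of \<open>m\<close> indicator functions.
\<close>

lemma staircase_approximation:
  fixes t :: real
  assumes "0 \<le> t" "t \<le> 1" "0 < m"
  shows "\<bar>t - (\<Sum>j=1..m. of_bool (real j / real m \<le> t)) / real m\<bar> \<le> 1 / real m"
proof -
  let ?k = "nat \<lfloor>real m * t\<rfloor>"
  have "real m * t \<le> real m" using assms by (simp add: mult_left_le)
  then have "j \<le> m" if "real j \<le> real m * t" for j using that by linarith
  then have "{j \<in> {1..m}. real j / real m \<le> t} = {1..?k}"
    using assms by (auto simp: field_simps le_nat_iff le_floor_iff)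
  then have "(\<Sum>j=1..m. of_bool (real j / real m \<le> t)) = real ?k"
    by (simp add: of_bool_def sum.If_cases Int_def)
  moreover have "\<bar>real m * t - real ?k\<bar> \<le> 1"
    using assms by (simp add: abs_le_iff) linarith
  moreover have "t - real ?k / real m = (real m * t - real ?k) / real m"
    using assms by (simp add: field_simps)
  ultimately show ?thesis
    using assms by (simp add: abs_divide divide_right_mono)
qed

lemma continuous_map_expect:
  fixes C :: "'a::topological_space measure set"
  assumes C: "compactin tau_topology C" and K: "is_test n K"
  shows "continuous_map (subtopology tau_topology C) euclideanreal (\<lambda>P. expect n P K)"
proof -
  let ?M = "Pi\<^sub>M {..<n} (\<lambda>_. borel :: 'a measure)"
  let ?T = "subtopology tau_topology C"
  define L where "L m j = {x \<in> space ?M. real j / real m \<le> K x}" for m j :: nat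
  let ?g = "\<lambda>m P. (\<Sum>j=1..m. measure (Pi\<^sub>M {..<n} (\<lambda>_. P)) (L m j)) / real m"
  have T: "topspace ?T \<subseteq> prob_measures"
    by (simp add: topspace_tau_topology)
  have L: "L m j \<in> sets ?M" for m j
  proof -
    have [measurable]: "K \<in> borel_measurable ?M" using K by (simp add: is_test_def)
    show ?thesis unfolding L_def by measurable
  qed
  have approx: "dist (?g m P) (expect n P K) \<le> 1 / real m" if m: "m > 0" and P: "P \<in> prob_measures" for m P
  proof -
    interpret PI: prob_space "Pi\<^sub>M {..<n} (\<lambda>_. P)" by (rule prob_space_PiM_prob_measures[OF P])
    have L': "L m j \<in> PI.events" for j
      using L by (simp add: sets_PiM_prob_measures[OF P])
    let ?h = "\<lambda>x. (\<Sum>j=1..m. indicator (L m j) x) / real m :: real"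
    have h: "integrable (Pi\<^sub>M {..<n} (\<lambda>_. P)) ?h"
      using L' by (intro integrable_divide Bochner_Integration.integrable_sum integrable_real_indicator)
                  (auto simp: PI.emeasure_eq_measure)
    have g: "?g m P = PI.expectation ?h"
      using L' by (simp add: PI.emeasure_eq_measure)
    have Kh: "integrable (Pi\<^sub>M {..<n} (\<lambda>_. P)) (\<lambda>x. K x - ?h x)"
      by (intro Bochner_Integration.integrable_diff integrable_test[OF P K] h)
    have "dist (?g m P) (expect n P K) = \<bar>PI.expectation (\<lambda>x. K x - ?h x)\<bar>"
      unfolding g expect_def
      by (subst Bochner_Integration.integral_diff[OF integrable_test[OF P K] h]) (simp add: dist_real_def)
    also have "\<dots> \<le> PI.expectation (\<lambda>x. \<bar>K x - ?h x\<bar>)"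
      by (rule integral_abs_bound)
    also have "\<dots> \<le> PI.expectation (\<lambda>x. 1 / real m)"
    proof (rule integral_mono)
      fix x assume "x \<in> space (Pi\<^sub>M {..<n} (\<lambda>_. P))"
      then have x: "x \<in> space ?M" by (simp add: space_PiM_prob_measures[OF P])
      then have "(\<Sum>j=1..m. indicator (L m j) x) = (\<Sum>j=1..m. of_bool (real j / real m \<le> K x) :: real)"
        by (intro sum.cong) (auto simp: L_def indicator_def)
      then show "\<bar>K x - ?h x\<bar> \<le> 1 / real m"
        using staircase_approximation[of "K x" m] K x m by (simp add: is_test_def)
    qed (use Kh in auto)
    also have "\<dots> = 1 / real m" by (simp add: PI.prob_space)
    finally show ?thesis .
  qed
  show ?thesis
    unfolding mtopology_is_euclidean[symmetric]
  proof (rule Met_TC.continuous_map_uniform_limit_alt)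
    show "\<forall>\<^sub>F m in sequentially. continuous_map ?T Met_TC.mtopology (?g m)"
      using continuous_map_measure_PiM[OF C L]
      by (auto intro!: continuous_intros eventually_mono[OF eventually_gt_at_top[of 0]])
    fix \<epsilon> :: real assume "\<epsilon> > 0"
    then have "\<forall>\<^sub>F m in sequentially. 1 / real m < \<epsilon>"
      by real_asymp
    then show "\<forall>\<^sub>F m in sequentially. \<forall>P\<in>topspace ?T. dist (?g m P) (expect n P K) < \<epsilon>"
      using eventually_gt_at_top[of 0]
    proof eventually_elim
      case (elim m)
      then show ?case using T approx[of m] by (meson le_less_trans subsetD)
    qed
  qed auto
qed

section \<open>Hypotheses with a common limit law\<close>

text \<open>
  By continuity, a bound on the expected values over \<open>\<Theta>\<close> persists on the closure: no test can treat
  a limit law differently from the laws that approach it.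
\<close>

lemma expect_closure_le_error:
  assumes "tau_relatively_compact \<Theta>" "\<Theta> \<subseteq> prob_measures"
    and R: "R \<in> tau_topology closure_of \<Theta>" and K: "is_test n K"
  shows "ennreal (expect n R K) \<le> error_alpha \<Theta> n K"
proof (cases "error_alpha \<Theta> n K")
  case (real a)
  let ?C = "tau_topology closure_of \<Theta>"
  let ?S = "{P \<in> topspace (subtopology tau_topology ?C). expect n P K \<in> {..a}}"
  have "continuous_map (subtopology tau_topology ?C) euclideanreal (\<lambda>P. expect n P K)"
    using assms(1) by (intro continuous_map_expect K) (simp add: tau_relatively_compact_def)
  then have "closedin (subtopology tau_topology ?C) ?S"
    by (rule closedin_continuous_map_preimage) simp
  then have "closedin tau_topology ?S"
    by (rule closedin_trans_full) simp
  moreover have "\<Theta> \<subseteq> ?S"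
  proof
    fix P assume P: "P \<in> \<Theta>"
    then have "ennreal (expect n P K) \<le> ennreal a"
      unfolding real(2)[symmetric] error_alpha_def by (rule SUP_upper)
    then have "expect n P K \<le> a" using real(1) by simp
    moreover have "P \<in> ?C"
      using P assms(2) closure_of_subset[of \<Theta> tau_topology] by (auto simp: topspace_tau_topology)
    ultimately show "P \<in> ?S"
      using P assms(2) by (auto simp: topspace_tau_topology)
  qed
  ultimately have "?C \<subseteq> ?S" by (intro closure_of_minimal)
  with R real show ?thesis by (auto intro: ennreal_leI)
next
  case top
  then show ?thesis by simp
qed

text \<open>
  A law \<open>R\<close> in both closures is a limit of the null hypothesis and of the alternative, so the errors
  are at least the probabilities of rejecting and of accepting under \<open>R\<close>, which add up to one.
\<close>

lemma indistinguishable_if_closures_meet: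
  assumes "tau_relatively_compact \<Theta>0" "tau_relatively_compact \<Theta>1"
    and "\<Theta>0 \<subseteq> prob_measures" "\<Theta>1 \<subseteq> prob_measures"
    and "(tau_topology closure_of \<Theta>0) \<inter> (tau_topology closure_of \<Theta>1) \<noteq> {}"
  shows "indistinguishable \<Theta>0 \<Theta>1"
  unfolding indistinguishable_def
proof (intro allI impI)
  fix n K assume K: "is_test n (K :: (nat \<Rightarrow> 'a) \<Rightarrow> real)"
  from assms(5) obtain R where R: "R \<in> tau_topology closure_of \<Theta>0" "R \<in> tau_topology closure_of \<Theta>1"
    by blast
  then have Rp: "R \<in> prob_measures"
    by (auto simp: in_closure_of topspace_tau_topology)
  have "1 = ennreal (expect n R K + expect n R (\<lambda>x. 1 - K x))"
    by (simp add: expect_complement[OF Rp K])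
  also have "\<dots> = ennreal (expect n R K) + ennreal (expect n R (\<lambda>x. 1 - K x))"
    by (intro ennreal_plus expect_nonneg Rp K is_test_complement)
  also have "\<dots> \<le> error_alpha \<Theta>0 n K + error_beta \<Theta>1 n K"
    unfolding error_beta_eq_error_alpha
    by (intro add_mono expect_closure_le_error assms R K is_test_complement)
  finally show "1 \<le> error_alpha \<Theta>0 n K + error_beta \<Theta>1 n K" .
qed

section \<open>Separation by finitely many events\<close>

lemma openin_tau_ball:
  assumes "finite F" "F \<subseteq> sets borel"
  shows "openin tau_topology {Q \<in> prob_measures. \<forall>B\<in>F. \<bar>measure Q B - c B\<bar> < e}"
  using assms
proof (induction F)
  case empty
  then show ?case using openin_topspace[of tau_topology] by (simp add: topspace_tau_topology)
next
  case (insert B F)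
  have "openin tau_topology {Q \<in> topspace tau_topology. measure Q B \<in> ball (c B) e}"
    using insert.prems by (intro openin_continuous_map_preimage[OF continuous_map_tau_topology]) auto
  with insert have "openin tau_topology ({Q \<in> topspace tau_topology. measure Q B \<in> ball (c B) e} \<inter>
      {Q \<in> prob_measures. \<forall>B\<in>F. \<bar>measure Q B - c B\<bar> < e})"
    by (intro openin_Int) auto
  moreover have "{Q \<in> topspace tau_topology. measure Q B \<in> ball (c B) e} \<inter>
      {Q \<in> prob_measures. \<forall>B\<in>F. \<bar>measure Q B - c B\<bar> < e} =
      {Q \<in> prob_measures. \<forall>B\<in>insert B F. \<bar>measure Q B - c B\<bar> < e}"
    by (auto simp: topspace_tau_topology dist_real_def abs_minus_commute)
  ultimately show ?case by simp
qed

text \<open>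
  Basic neighbourhoods in the \<open>\<tau>\<close>-topology constrain finitely many events only; this is why finitely
  many empirical frequencies will suffice for testing.
\<close>

lemma tau_neighbourhood_contains_ball:
  assumes "openin tau_topology V" "P \<in> V"
  shows "\<exists>F e. finite F \<and> F \<subseteq> sets borel \<and> 0 < e \<and>
           {Q \<in> prob_measures. \<forall>B\<in>F. \<bar>measure Q B - measure P B\<bar> < e} \<subseteq> V"
  using openin_topology_generated_by[OF assms(1)[unfolded tau_topology_def]] assms(2)
proof induction
  case Empty
  then show ?case by simp
next
  case (Int V W)
  then have "P \<in> V" "P \<in> W" by blast+
  from Int.IH(1)[OF this(1)] obtain F e where F: "finite F" "F \<subseteq> sets borel" "0 < e"
      "{Q \<in> prob_measures. \<forall>B\<in>F. \<bar>measure Q B - measure P B\<bar> < e} \<subseteq> V"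
    by blast
  from Int.IH(2)[OF \<open>P \<in> W\<close>] obtain G d where G: "finite G" "G \<subseteq> sets borel" "0 < d"
      "{Q \<in> prob_measures. \<forall>B\<in>G. \<bar>measure Q B - measure P B\<bar> < d} \<subseteq> W"
    by blast
  have "{Q \<in> prob_measures. \<forall>B\<in>F \<union> G. \<bar>measure Q B - measure P B\<bar> < min e d} \<subseteq> V \<inter> W"
    using F(4) G(4) by auto
  with F G show ?case
    by (intro exI[of _ "F \<union> G"] exI[of _ "min e d"]) simp
next
  case (UN \<V>)
  then obtain V where V: "V \<in> \<V>" "P \<in> V" by blast
  with UN.IH[of V] obtain F e where "finite F" "F \<subseteq> sets borel" "0 < e"
      "{Q \<in> prob_measures. \<forall>B\<in>F. \<bar>measure Q B - measure P B\<bar> < e} \<subseteq> V"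
    by blast
  with V(1) show ?case by (intro exI[of _ F] exI[of _ e]) auto
next
  case (Basis V)
  then obtain B U where V: "V = {Q \<in> prob_measures. measure Q B \<in> U}" "B \<in> sets borel" "open U"
    by blast
  with Basis obtain e where "0 < e" "ball (measure P B) e \<subseteq> U"
    by (auto simp: open_contains_ball)
  with V show ?case
    by (intro exI[of _ "{B}"] exI[of _ e]) (auto simp: subset_iff dist_real_def abs_minus_commute)
qed

text \<open>
  Every \<open>P \<in> C\<close> has a basic neighbourhood of some radius \<open>e P\<close> that misses \<open>D\<close>. Finitely many of the
  neighbourhoods with half that radius cover \<open>C\<close>; a law in one of them keeps the other half of the
  radius as its distance from \<open>D\<close>, measured on the events of that neighbourhood.
\<close>

lemma finitely_many_events_separate:
  assumes C: "compactin tau_topology C" and D: "closedin tau_topology D" and "C \<inter> D = {}"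
  shows "\<exists>F \<delta>. finite F \<and> F \<subseteq> sets borel \<and> 0 < \<delta> \<and>
           (\<forall>P\<in>C. \<forall>Q\<in>D. \<exists>B\<in>F. \<delta> \<le> \<bar>measure P B - measure Q B\<bar>)"
proof -
  have "C \<subseteq> topspace tau_topology - D"
    using compactin_subset_topspace[OF C] assms(3) by blast
  moreover have "openin tau_topology (topspace tau_topology - D)"
    using D by blast
  ultimately have "\<forall>P\<in>C. \<exists>F e. finite F \<and> F \<subseteq> sets borel \<and> 0 < e \<and>
      {Q \<in> prob_measures. \<forall>B\<in>F. \<bar>measure Q B - measure P B\<bar> < e} \<subseteq> topspace tau_topology - D"
    by (intro ballI tau_neighbourhood_contains_ball) auto
  from bchoice[OF this] obtain F where "\<forall>P\<in>C. \<exists>e. finite (F P) \<and> F P \<subseteq> sets borel \<and> 0 < e \<and>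
      {Q \<in> prob_measures. \<forall>B\<in>F P. \<bar>measure Q B - measure P B\<bar> < e} \<subseteq> topspace tau_topology - D" ..
  from bchoice[OF this] obtain e where Fe: "\<forall>P\<in>C. finite (F P) \<and> F P \<subseteq> sets borel \<and> 0 < e P \<and>
      {Q \<in> prob_measures. \<forall>B\<in>F P. \<bar>measure Q B - measure P B\<bar> < e P} \<subseteq> topspace tau_topology - D" ..
  then have F: "finite (F P)" "F P \<subseteq> sets borel" and e: "0 < e P"
    and FD: "{Q \<in> prob_measures. \<forall>B\<in>F P. \<bar>measure Q B - measure P B\<bar> < e P} \<subseteq> topspace tau_topology - D"
    if "P \<in> C" for P
    using that by (simp_all only: bspec[OF Fe that])
  define U where "U P = {Q \<in> prob_measures. \<forall>B\<in>F P. \<bar>measure Q B - measure P B\<bar> < e P / 2}" for P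
  have "openin tau_topology (U P)" if "P \<in> C" for P
    unfolding U_def by (rule openin_tau_ball[OF F[OF that]])
  then have "openin tau_topology W" if "W \<in> U ` C" for W
    using that by blast
  moreover have "C \<subseteq> \<Union>(U ` C)"
    using e compactin_subset_topspace[OF C] by (auto simp: U_def topspace_tau_topology)
  ultimately obtain \<F> where "finite \<F>" "\<F> \<subseteq> U ` C" "C \<subseteq> \<Union>\<F>"
    using compactinD[OF C, of "U ` C"] by blast
  then obtain I where I: "finite I" "I \<subseteq> C" "C \<subseteq> \<Union>(U ` I)"
    by (metis finite_subset_image)
  \<comment> \<open>The 1 keeps the minimum meaningful when \<open>C\<close>, and hence \<open>I\<close>, is empty.\<close>
  define \<delta> where "\<delta> = Min (insert 1 ((\<lambda>P. e P / 2) ` I))"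
  have "0 < \<delta>"
    using I e by (auto simp: \<delta>_def)
  moreover have "\<exists>B\<in>\<Union>(F ` I). \<delta> \<le> \<bar>measure P B - measure Q B\<bar>" if P: "P \<in> C" and Q: "Q \<in> D" for P Q
  proof -
    from I(3) P obtain P' where P': "P' \<in> I" "P \<in> U P'" by blast
    have "Q \<in> prob_measures"
      using closedin_subset[OF D] Q by (auto simp: topspace_tau_topology)
    moreover have "Q \<notin> {Q \<in> prob_measures. \<forall>B\<in>F P'. \<bar>measure Q B - measure P' B\<bar> < e P'}"
      using FD[of P'] P'(1) I(2) Q by blast
    ultimately obtain B where B: "B \<in> F P'" "e P' \<le> \<bar>measure Q B - measure P' B\<bar>"
      by (auto simp: not_less)
    have "\<bar>measure P B - measure P' B\<bar> < e P' / 2"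
      using P'(2) B(1) by (simp add: U_def)
    moreover have "\<delta> \<le> e P' / 2"
      unfolding \<delta>_def using I P'(1) by (intro Min_le) auto
    ultimately have "\<delta> \<le> \<bar>measure P B - measure Q B\<bar>"
      using B(2) by linarith
    with B(1) P'(1) show ?thesis by blast
  qed
  moreover have "finite (\<Union>(F ` I))"
    using I F(1) by auto
  moreover have "\<Union>(F ` I) \<subseteq> sets borel"
    using I(2) F(2) by blast
  ultimately show ?thesis by blast
qed

text \<open>
  The distance between two laws on a finite family of events is symmetric, so either of the two
  closures may take the part of the compact set.
\<close>

lemma finitely_many_events_separate_hypotheses:
  assumes rc: "tau_relatively_compact \<Theta>0 \<or> tau_relatively_compact \<Theta>1"
    and \<Theta>: "\<Theta>0 \<subseteq> prob_measures" "\<Theta>1 \<subseteq> prob_measures"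
    and disj: "(tau_topology closure_of \<Theta>0) \<inter> (tau_topology closure_of \<Theta>1) = {}"
  shows "\<exists>F \<delta>. finite F \<and> F \<subseteq> sets borel \<and> 0 < \<delta> \<and>
           (\<forall>P\<in>\<Theta>0. \<forall>Q\<in>\<Theta>1. \<exists>B\<in>F. \<delta> \<le> \<bar>measure P B - measure Q B\<bar>)"
proof -
  let ?C = "tau_topology closure_of \<Theta>0" and ?D = "tau_topology closure_of \<Theta>1"
  have "\<exists>F \<delta>. finite F \<and> F \<subseteq> sets borel \<and> 0 < \<delta> \<and>
          (\<forall>P\<in>?C. \<forall>Q\<in>?D. \<exists>B\<in>F. \<delta> \<le> \<bar>measure P B - measure Q B\<bar>)"
    using rc
  proof
    assume "tau_relatively_compact \<Theta>0"
    then show ?thesis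
      using disj by (intro finitely_many_events_separate) (auto simp: tau_relatively_compact_def)
  next
    assume "tau_relatively_compact \<Theta>1"
    then have "\<exists>F \<delta>. finite F \<and> F \<subseteq> sets borel \<and> 0 < \<delta> \<and>
          (\<forall>Q\<in>?D. \<forall>P\<in>?C. \<exists>B\<in>F. \<delta> \<le> \<bar>measure Q B - measure P B\<bar>)"
      using disj by (intro finitely_many_events_separate) (auto simp: tau_relatively_compact_def)
    then obtain F \<delta> where F: "finite F" "F \<subseteq> sets borel" "0 < \<delta>"
      and sep: "\<forall>Q\<in>?D. \<forall>P\<in>?C. \<exists>B\<in>F. \<delta> \<le> \<bar>measure Q B - measure P B\<bar>"
      by (elim exE conjE)
    have "\<exists>B\<in>F. \<delta> \<le> \<bar>measure P B - measure Q B\<bar>" if "P \<in> ?C" "Q \<in> ?D" for P Q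
      using bspec[OF bspec[OF sep that(2)] that(1)] by (simp add: abs_minus_commute)
    then have "\<forall>P\<in>?C. \<forall>Q\<in>?D. \<exists>B\<in>F. \<delta> \<le> \<bar>measure P B - measure Q B\<bar>" by simp
    with F show ?thesis by (intro exI[of _ F] exI[of _ \<delta>] conjI)
  qed
  then obtain F \<delta> where F: "finite F" "F \<subseteq> sets borel" "0 < \<delta>"
    and sep: "\<forall>P\<in>?C. \<forall>Q\<in>?D. \<exists>B\<in>F. \<delta> \<le> \<bar>measure P B - measure Q B\<bar>"
    by (elim exE conjE)
  have "\<Theta>0 \<subseteq> ?C" "\<Theta>1 \<subseteq> ?D"
    using \<Theta> by (auto intro!: closure_of_subset simp: topspace_tau_topology)
  with sep have "\<forall>P\<in>\<Theta>0. \<forall>Q\<in>\<Theta>1. \<exists>B\<in>F. \<delta> \<le> \<bar>measure P B - measure Q B\<bar>"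
    by (meson subsetD)
  with F show ?thesis by (intro exI[of _ F] exI[of _ \<delta>] conjI)
qed

section \<open>Tests based on empirical frequencies\<close>

lemma hoeffding_relative_frequency:
  fixes P :: "'a::topological_space measure" and n :: nat
  assumes P: "P \<in> prob_measures" and B: "B \<in> sets borel" and "n > 0" "t \<ge> 0"
  shows "measure (Pi\<^sub>M {..<n} (\<lambda>_. P))
           {x \<in> space (Pi\<^sub>M {..<n} (\<lambda>_. borel)). t \<le> \<bar>(\<Sum>i<n. indicator B (x i)) / real n - measure P B\<bar>}
         \<le> 2 * exp (- 2 * real n * t\<^sup>2)"
proof -
  let ?M = "Pi\<^sub>M {..<n} (\<lambda>_. P)"
  have Pp: "prob_space P" and sP [measurable_cong]: "sets P = sets borel"
    using P by (auto simp: prob_measures_iff)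
  interpret PI: prob_space ?M by (rule prob_space_PiM_prob_measures[OF P])
  have comp: "distr ?M P (\<lambda>x. x i) = P" if "i < n" for i
    using that Pp by (intro distr_PiM_component) auto
  \<comment> \<open>The observations are independent because their joint law is the product of the marginals.\<close>
  have "PI.indep_vars (\<lambda>_. P) (\<lambda>i x. x i) {..<n}"
  proof (subst PI.indep_vars_iff_distr_eq_PiM')
    have "distr ?M ?M (\<lambda>x. \<lambda>i\<in>{..<n}. x i) = distr ?M ?M (\<lambda>x. x)"
      by (intro distr_cong) (auto simp: space_PiM PiE_def extensional_restrict)
    also have "\<dots> = (\<Pi>\<^sub>M i\<in>{..<n}. distr ?M P (\<lambda>x. x i))"
      by (subst distr_id) (intro PiM_cong; simp add: comp)
    finally show "distr ?M ?M (\<lambda>x. \<lambda>i\<in>{..<n}. x i) = (\<Pi>\<^sub>M i\<in>{..<n}. distr ?M P (\<lambda>x. x i))" .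
  qed (use \<open>n > 0\<close> in auto)
  then have indep: "PI.indep_vars (\<lambda>_. borel) (\<lambda>i x. indicator B (x i) :: real) {..<n}"
    by (rule PI.indep_vars_compose2) (use B in measurable)
  interpret H: Hoeffding_ineq ?M "{..<n}" "\<lambda>i x. indicator B (x i) :: real" "\<lambda>_. 0" "\<lambda>_. 1"
      "\<Sum>i<n. PI.expectation (\<lambda>x. indicator B (x i))"
    by unfold_locales (auto simp: indep)
  have "PI.expectation (\<lambda>x. indicator B (x i) :: real) = measure P B" if "i < n" for i
  proof -
    have "PI.expectation (\<lambda>x. indicator B (x i) :: real) = (\<integral>y. indicator B y \<partial>distr ?M P (\<lambda>x. x i))"
      using that B sP
      by (intro integral_distr[symmetric] measurable_component_singleton borel_measurable_indicator) auto
    then show ?thesis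
      using that B sets_eq_imp_space_eq[OF sP] by (simp add: comp)
  qed
  then have mu: "(\<Sum>i<n. PI.expectation (\<lambda>x. indicator B (x i) :: real)) = real n * measure P B"
    by simp
  have "{x \<in> space ?M. real n * t \<le> \<bar>(\<Sum>i<n. indicator B (x i)) - real n * measure P B\<bar>} =
        {x \<in> space (Pi\<^sub>M {..<n} (\<lambda>_. borel)). t \<le> \<bar>(\<Sum>i<n. indicator B (x i)) / real n - measure P B\<bar>}"
  proof -
    have "real n * t \<le> \<bar>s - real n * p\<bar> \<longleftrightarrow> t \<le> \<bar>s / real n - p\<bar>" for s p :: real
    proof -
      have "\<bar>s - real n * p\<bar> = real n * \<bar>s / real n - p\<bar>"
        using \<open>n > 0\<close> by (simp add: abs_mult_pos'[symmetric] field_simps)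
      then show ?thesis using \<open>n > 0\<close> by simp
    qed
    then show ?thesis by (simp add: space_PiM_prob_measures[OF P])
  qed
  moreover have "- 2 * (real n * t)\<^sup>2 / real n = - 2 * real n * t\<^sup>2"
    using \<open>n > 0\<close> by (simp add: power2_eq_square)
  ultimately show ?thesis
    using H.Hoeffding_ineq_abs_ge[of "real n * t"] \<open>n > 0\<close> \<open>t \<ge> 0\<close> by (simp add: mu)
qed

lemma hoeffding_finitely_many_events:
  fixes P :: "'a::topological_space measure" and n :: nat
  assumes P: "P \<in> prob_measures" and F: "finite F" "F \<subseteq> sets borel" and "n > 0" "t \<ge> 0"
  defines "A \<equiv> {x \<in> space (Pi\<^sub>M {..<n} (\<lambda>_. borel)).
                  \<exists>B\<in>F. t \<le> \<bar>(\<Sum>i<n. indicator B (x i)) / real n - measure P B\<bar>}"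
  shows "A \<in> sets (Pi\<^sub>M {..<n} (\<lambda>_. borel))"
    and "measure (Pi\<^sub>M {..<n} (\<lambda>_. P)) A \<le> 2 * real (card F) * exp (- 2 * real n * t\<^sup>2)"
proof -
  let ?M = "Pi\<^sub>M {..<n} (\<lambda>_. borel :: 'a measure)"
  define A' where "A' B = {x \<in> space ?M. t \<le> \<bar>(\<Sum>i<n. indicator B (x i)) / real n - measure P B\<bar>}" for B
  interpret PI: prob_space "Pi\<^sub>M {..<n} (\<lambda>_. P)" by (rule prob_space_PiM_prob_measures[OF P])
  have A: "A = (\<Union>B\<in>F. A' B)" by (auto simp: A_def A'_def)
  have A': "A' B \<in> sets ?M" if "B \<in> F" for B
  proof -
    have [measurable]: "B \<in> sets borel" using that F by blast
    show ?thesis unfolding A'_def by measurable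
  qed
  then show "A \<in> sets ?M" unfolding A using F by blast
  have "PI.prob A \<le> (\<Sum>B\<in>F. PI.prob (A' B))"
    unfolding A using A' F(1)
    by (intro PI.finite_measure_subadditive_finite) (auto simp: sets_PiM_prob_measures[OF P])
  also have "\<dots> \<le> (\<Sum>B\<in>F. 2 * exp (- 2 * real n * t\<^sup>2))"
    unfolding A'_def using F(2) assms(4,5) by (intro sum_mono hoeffding_relative_frequency P) auto
  finally show "PI.prob A \<le> 2 * real (card F) * exp (- 2 * real n * t\<^sup>2)" by simp
qed

text \<open>
  Accepts (value 0) when some law in \<open>\<Theta>\<close> agrees with the empirical frequencies of all events in \<open>F\<close>
  up to the tolerance \<open>t\<close>: the minimum distance test based on \<open>F\<close>.
\<close>

definition frequency_test ::
    "'a::topological_space set set \<Rightarrow> real \<Rightarrow> 'a measure set \<Rightarrow> nat \<Rightarrow> (nat \<Rightarrow> 'a) \<Rightarrow> real" where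
  "frequency_test F t \<Theta> n x =
     of_bool (\<not> (\<exists>P\<in>\<Theta>. \<forall>B\<in>F. \<bar>(\<Sum>i<n. indicator B (x i)) / real n - measure P B\<bar> < t))"

text \<open>
  The existential quantifier ranges over an arbitrary set of laws, so the set is not visibly a
  countable union. Since the functions \<open>f B\<close> take finitely many values, it is a finite union of
  joint level sets.
\<close>

lemma sets_Collect_Bex_finite_range:
  assumes "finite F" "finite V"
    and f: "\<And>B. B \<in> F \<Longrightarrow> f B \<in> borel_measurable M"
    and V: "\<And>B x. B \<in> F \<Longrightarrow> x \<in> space M \<Longrightarrow> f B x \<in> (V :: real set)"
  shows "{x \<in> space M. \<exists>P\<in>\<Theta>. \<forall>B\<in>F. \<phi> P B (f B x)} \<in> sets M"
proof -
  let ?W = "{v \<in> F \<rightarrow>\<^sub>E V. \<exists>P\<in>\<Theta>. \<forall>B\<in>F. \<phi> P B (v B)}"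
  have "{x \<in> space M. \<exists>P\<in>\<Theta>. \<forall>B\<in>F. \<phi> P B (f B x)} = (\<Union>v\<in>?W. {x \<in> space M. \<forall>B\<in>F. f B x = v B})"
  proof (intro equalityI subsetI)
    fix x assume x: "x \<in> {x \<in> space M. \<exists>P\<in>\<Theta>. \<forall>B\<in>F. \<phi> P B (f B x)}"
    have "(\<lambda>B\<in>F. f B x) \<in> F \<rightarrow>\<^sub>E V"
      unfolding restrict_PiE_iff using x V by blast
    moreover have "\<exists>P\<in>\<Theta>. \<forall>B\<in>F. \<phi> P B ((\<lambda>B\<in>F. f B x) B)"
      using x by simp
    ultimately have W: "(\<lambda>B\<in>F. f B x) \<in> ?W" by (intro CollectI conjI)
    then show "x \<in> (\<Union>v\<in>?W. {x \<in> space M. \<forall>B\<in>F. f B x = v B})"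
      using x by (intro UN_I[OF W]) simp
  qed (auto; blast)
  moreover have "finite ?W"
    using assms(1,2) by (intro finite_Collect_conjI disjI1) (auto intro: finite_PiE)
  moreover have "{x \<in> space M. \<forall>B\<in>F. f B x = v B} \<in> sets M" for v
    using f assms(1) by (intro sets.sets_Collect_finite_All borel_measurable_eq) auto
  ultimately show ?thesis by auto
qed

lemma is_test_frequency_test:
  assumes "finite F" "F \<subseteq> sets (borel :: 'a::topological_space measure)"
  shows "is_test n (frequency_test F t \<Theta> n)"
proof -
  let ?M = "Pi\<^sub>M {..<n} (\<lambda>_. borel :: 'a measure)"
  let ?f = "\<lambda>B x. (\<Sum>i<n. indicator B (x i)) / real n :: real"
  let ?A = "{x \<in> space ?M. \<exists>P\<in>\<Theta>. \<forall>B\<in>F. \<bar>?f B x - measure P B\<bar> < t}"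
  have "?A \<in> sets ?M"
  proof (rule sets_Collect_Bex_finite_range)
    show "finite ((\<lambda>k. real k / real n) ` {..n})" by simp
    fix B assume "B \<in> F"
    then have [measurable]: "B \<in> sets borel" using assms by blast
    show "?f B \<in> borel_measurable ?M" by measurable
    fix x
    have "(\<Sum>i<n. indicator B (x i)) = real (card {i \<in> {..<n}. x i \<in> B})"
      by (simp add: indicator_def sum.If_cases Int_def)
    moreover have "card {i \<in> {..<n}. x i \<in> B} \<le> card {..<n}"
      by (intro card_mono) auto
    ultimately show "?f B x \<in> (\<lambda>k. real k / real n) ` {..n}" by auto
  qed fact
  then have "(\<lambda>x. 1 - indicator ?A x :: real) \<in> borel_measurable ?M" by measurable
  moreover have "frequency_test F t \<Theta> n x = 1 - indicator ?A x" if "x \<in> space ?M" for x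
    using that by (auto simp: frequency_test_def indicator_def)
  ultimately have "frequency_test F t \<Theta> n \<in> borel_measurable ?M"
    by (simp cong: measurable_cong)
  then show ?thesis by (auto simp: is_test_def frequency_test_def)
qed

lemma exp_absorbs_factor:
  assumes "0 < (a::real)"
  shows "\<exists>n0. \<forall>n>n0. c * exp (- a * real n) \<le> exp (- (a / 2) * real n)"
proof -
  have "\<forall>\<^sub>F n in sequentially. c \<le> exp (a / 2 * real n)"
    using assms by real_asymp
  then obtain n0 where n0: "\<And>n. n \<ge> n0 \<Longrightarrow> c \<le> exp (a / 2 * real n)"
    by (auto simp: eventually_sequentially)
  have "c * exp (- a * real n) \<le> exp (- (a / 2) * real n)" if "n \<ge> n0" for n
  proof -
    have "c * exp (- a * real n) \<le> exp (a / 2 * real n) * exp (- a * real n)"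
      using n0[OF that] by (intro mult_right_mono) auto
    also have "\<dots> = exp (- (a / 2) * real n)"
      by (simp add: exp_add[symmetric])
    finally show ?thesis .
  qed
  then show ?thesis by (meson less_imp_le)
qed

text \<open>
  If two hypotheses differ by \<open>\<delta>\<close> on some event of \<open>F\<close>, then frequencies that are within \<open>\<delta> / 2\<close> of
  the true probabilities on all of \<open>F\<close> are accepted under \<open>\<Theta>0\<close> and rejected under \<open>\<Theta>1\<close>. So either
  error requires a deviation of at least \<open>\<delta> / 2\<close> on one of finitely many events, and Hoeffding's
  inequality makes this exponentially unlikely, uniformly in the law. Half of the exponent \<open>a\<close> is
  given up to absorb the factor \<open>2 * card F\<close>.
\<close>

lemma exponentially_consistent_tests:
  fixes \<Theta>0 \<Theta>1 :: "'a::topological_space measure set"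
  assumes \<Theta>: "\<Theta>0 \<subseteq> prob_measures" "\<Theta>1 \<subseteq> prob_measures"
    and F: "finite F" "F \<subseteq> sets borel" and "0 < \<delta>"
    and sep: "\<And>P Q. P \<in> \<Theta>0 \<Longrightarrow> Q \<in> \<Theta>1 \<Longrightarrow> \<exists>B\<in>F. \<delta> \<le> \<bar>measure P B - measure Q B\<bar>"
  shows "\<exists>(K :: nat \<Rightarrow> (nat \<Rightarrow> 'a) \<Rightarrow> real) (c::real) (n0::nat).
           (\<forall>n\<ge>1. is_test n (K n)) \<and> c > 0 \<and>
           (\<forall>n>n0. error_alpha \<Theta>0 n (K n) \<le> ennreal (exp (- c * real n)) \<and>
                   error_beta \<Theta>1 n (K n) \<le> ennreal (exp (- c * real n)))"
proof -
  let ?K = "frequency_test F (\<delta>/2) \<Theta>0"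
  let ?A = "\<lambda>P n. {x \<in> space (Pi\<^sub>M {..<n} (\<lambda>_. borel)).
      \<exists>B\<in>F. \<delta>/2 \<le> \<bar>(\<Sum>i<n. indicator B (x i)) / real n - measure P B\<bar>}"
  define a where "a = 2 * (\<delta>/2)\<^sup>2"
  have "0 < a" using \<open>0 < \<delta>\<close> by (simp add: a_def)
  then obtain n0 where n0:
    "\<And>n. n > n0 \<Longrightarrow> 2 * real (card F) * exp (- a * real n) \<le> exp (- (a / 2) * real n)"
    using exp_absorbs_factor by blast
  have test: "is_test n (?K n)" for n by (rule is_test_frequency_test[OF F])
  have bound: "ennreal (expect n P K) \<le> ennreal (exp (- (a / 2) * real n))"
    if n: "n > n0" and P: "P \<in> prob_measures" and K: "is_test n K"
      and KA: "\<And>x. x \<in> space (Pi\<^sub>M {..<n} (\<lambda>_. borel)) \<Longrightarrow> x \<notin> ?A P n \<Longrightarrow> K x = 0" for n P K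
  proof -
    have "expect n P K \<le> measure (Pi\<^sub>M {..<n} (\<lambda>_. P)) (?A P n)"
      using n \<open>0 < \<delta>\<close>
      by (intro expect_le_measure P K KA hoeffding_finitely_many_events(1)[OF P F]) auto
    also have "\<dots> \<le> 2 * real (card F) * exp (- 2 * real n * (\<delta>/2)\<^sup>2)"
      using n \<open>0 < \<delta>\<close> by (intro hoeffding_finitely_many_events(2)[OF P F]) auto
    also have "- 2 * real n * (\<delta>/2)\<^sup>2 = - a * real n" by (simp add: a_def)
    also note n0[OF n]
    finally show ?thesis by (rule ennreal_leI)
  qed
  have "error_alpha \<Theta>0 n (?K n) \<le> ennreal (exp (- (a / 2) * real n))" if "n > n0" for n
    unfolding error_alpha_def
  proof (rule SUP_least, rule bound[OF that _ test])
    fix P x assume P: "P \<in> \<Theta>0"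
    then show "P \<in> prob_measures" using \<Theta> by blast
    assume "x \<in> space (Pi\<^sub>M {..<n} (\<lambda>_. borel))" "x \<notin> ?A P n"
    with P show "?K n x = 0" by (auto simp: frequency_test_def not_le)
  qed
  moreover have "error_beta \<Theta>1 n (?K n) \<le> ennreal (exp (- (a / 2) * real n))" if "n > n0" for n
    unfolding error_beta_def
  proof (rule SUP_least, rule bound[OF that _ is_test_complement[OF test]])
    fix Q x assume Q: "Q \<in> \<Theta>1"
    then show "Q \<in> prob_measures" using \<Theta> by blast
    assume x: "x \<in> space (Pi\<^sub>M {..<n} (\<lambda>_. borel))" "x \<notin> ?A Q n"
    have "\<not> (\<forall>B\<in>F. \<bar>(\<Sum>i<n. indicator B (x i)) / real n - measure P B\<bar> < \<delta>/2)" if P: "P \<in> \<Theta>0" for P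
    proof -
      obtain B where B: "B \<in> F" "\<delta> \<le> \<bar>measure P B - measure Q B\<bar>" using sep[OF P Q] by blast
      with x have "\<bar>(\<Sum>i<n. indicator B (x i)) / real n - measure Q B\<bar> < \<delta>/2"
        by (auto simp: not_le)
      with B(2) have "\<not> \<bar>(\<Sum>i<n. indicator B (x i)) / real n - measure P B\<bar> < \<delta>/2"
        by linarith
      with B(1) show ?thesis by blast
    qed
    then show "1 - ?K n x = 0" by (simp add: frequency_test_def)
  qed
  ultimately show ?thesis using test \<open>0 < a\<close>
    by (intro exI[of _ ?K] exI[of _ "a / 2"] exI[of _ n0]) simp
qed

text \<open>
  Distinguishability asks for level \<open>\<alpha>\<close> at every sample size. For the finitely many small sample sizes
  where the exponential bound is not yet valid or not yet below \<open>\<alpha>\<close>, the test that never rejects is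
  used.
\<close>

lemma distinguishable_if_exponentially_consistent:
  fixes K :: "nat \<Rightarrow> (nat \<Rightarrow> 'a::topological_space) \<Rightarrow> real"
  assumes test: "\<And>n. n \<ge> 1 \<Longrightarrow> is_test n (K n)" and "0 < (c::real)"
    and err: "\<And>n. n > n0 \<Longrightarrow> error_alpha \<Theta>0 n (K n) \<le> ennreal (exp (- c * real n))"
      "\<And>n. n > n0 \<Longrightarrow> error_beta \<Theta>1 n (K n) \<le> ennreal (exp (- c * real n))"
  shows "distinguishable \<Theta>0 \<Theta>1"
  unfolding distinguishable_def
proof (intro allI impI)
  fix \<alpha> :: real assume \<alpha>: "0 < \<alpha> \<and> \<alpha> < 1"
  have lim: "(\<lambda>n. exp (- c * real n)) \<longlonglongrightarrow> 0"
    using \<open>0 < c\<close> by real_asymp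
  then have "\<forall>\<^sub>F n in sequentially. exp (- c * real n) < \<alpha>"
    using \<alpha> by (auto simp: order_tendsto_iff)
  then obtain n1 where n1: "\<And>n. n \<ge> n1 \<Longrightarrow> exp (- c * real n) < \<alpha>"
    by (auto simp: eventually_sequentially)
  define K' where "K' n = (if n > max n0 n1 then K n else (\<lambda>_. 0))" for n
  have "is_test n (K' n)" if "n \<ge> 1" for n
    using test[OF that] by (auto simp: K'_def is_test_def)
  moreover have "error_alpha \<Theta>0 n (K' n) < ennreal \<alpha>" for n
  proof (cases "n > max n0 n1")
    case True
    have "ennreal (exp (- c * real n)) < ennreal \<alpha>"
      using n1[of n] True by (intro ennreal_lessI) (use \<alpha> in auto)
    with err(1)[of n] True show ?thesis by (simp add: K'_def)
  next
    case False
    have "error_alpha \<Theta>0 n (\<lambda>_. 0) \<le> 0"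
      unfolding error_alpha_def by (intro SUP_least) (simp add: expect_def)
    also have "0 < ennreal \<alpha>" using \<alpha> by simp
    also have "(\<lambda>_. 0) = K' n" unfolding K'_def by (rule if_not_P[OF False, symmetric])
    finally show ?thesis .
  qed
  moreover have "(\<lambda>n. error_beta \<Theta>1 n (K' n)) \<longlonglongrightarrow> 0"
  proof (rule tendsto_sandwich[where f = "\<lambda>_. 0"])
    show "(\<lambda>n. ennreal (exp (- c * real n))) \<longlonglongrightarrow> 0"
      using tendsto_ennrealI[OF lim] by simp
    show "\<forall>\<^sub>F n in sequentially. error_beta \<Theta>1 n (K' n) \<le> ennreal (exp (- c * real n))"
      using eventually_gt_at_top[of "max n0 n1"]
      by eventually_elim (use err(2) in \<open>simp add: K'_def\<close>)
  qed auto
  ultimately show "\<exists>K. (\<forall>n\<ge>1. is_test n (K n) \<and> error_alpha \<Theta>0 n (K n) < ennreal \<alpha>) \<and>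
      (\<lambda>n. error_beta \<Theta>1 n (K n)) \<longlonglongrightarrow> 0"
    by blast
qed

section \<open>The dichotomy\<close>

theorem theorem2p1:
  fixes \<Theta>0 \<Theta>1 :: "'a::t2_space measure set"
  assumes "\<Theta>0 \<subseteq> prob_measures" and "\<Theta>1 \<subseteq> prob_measures"
  shows "(tau_relatively_compact \<Theta>0 \<and> tau_relatively_compact \<Theta>1 \<and>
            (tau_topology closure_of \<Theta>0) \<inter> (tau_topology closure_of \<Theta>1) \<noteq> {}
          \<longrightarrow> indistinguishable \<Theta>0 \<Theta>1)
       \<and> ((tau_relatively_compact \<Theta>0 \<or> tau_relatively_compact \<Theta>1) \<and>
            (tau_topology closure_of \<Theta>0) \<inter> (tau_topology closure_of \<Theta>1) = {}
          \<longrightarrow> distinguishable \<Theta>0 \<Theta>1 \<and>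
              (\<exists>(K :: nat \<Rightarrow> (nat \<Rightarrow> 'a) \<Rightarrow> real) (c::real) (n0::nat).
                 (\<forall>n\<ge>1. is_test n (K n)) \<and> c > 0 \<and>
                 (\<forall>n>n0. error_alpha \<Theta>0 n (K n) \<le> ennreal (exp (- c * real n)) \<and>
                         error_beta \<Theta>1 n (K n) \<le> ennreal (exp (- c * real n)))))"
proof (intro conjI impI)
  assume "tau_relatively_compact \<Theta>0 \<and> tau_relatively_compact \<Theta>1 \<and>
            (tau_topology closure_of \<Theta>0) \<inter> (tau_topology closure_of \<Theta>1) \<noteq> {}"
  then show "indistinguishable \<Theta>0 \<Theta>1"
    using assms by (intro indistinguishable_if_closures_meet) auto
next
  assume *: "(tau_relatively_compact \<Theta>0 \<or> tau_relatively_compact \<Theta>1) \<and>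
            (tau_topology closure_of \<Theta>0) \<inter> (tau_topology closure_of \<Theta>1) = {}"
  then have "\<exists>F \<delta>. finite F \<and> F \<subseteq> sets borel \<and> 0 < \<delta> \<and>
      (\<forall>P\<in>\<Theta>0. \<forall>Q\<in>\<Theta>1. \<exists>B\<in>F. \<delta> \<le> \<bar>measure P B - measure Q B\<bar>)"
    by (intro finitely_many_events_separate_hypotheses assms) simp_all
  then obtain F \<delta> where F: "finite F" "F \<subseteq> sets borel" "0 < \<delta>"
    and sep: "\<forall>P\<in>\<Theta>0. \<forall>Q\<in>\<Theta>1. \<exists>B\<in>F. \<delta> \<le> \<bar>measure P B - measure Q B\<bar>"
    by (elim exE conjE)
  show tests: "\<exists>(K :: nat \<Rightarrow> (nat \<Rightarrow> 'a) \<Rightarrow> real) (c::real) (n0::nat).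
                 (\<forall>n\<ge>1. is_test n (K n)) \<and> c > 0 \<and>
                 (\<forall>n>n0. error_alpha \<Theta>0 n (K n) \<le> ennreal (exp (- c * real n)) \<and>
                         error_beta \<Theta>1 n (K n) \<le> ennreal (exp (- c * real n)))"
    by (rule exponentially_consistent_tests[OF assms F bspec[OF bspec[OF sep]]])
  then obtain K :: "nat \<Rightarrow> (nat \<Rightarrow> 'a) \<Rightarrow> real" and c :: real and n0 :: nat where
    "\<forall>n\<ge>1. is_test n (K n)" "c > 0"
    "\<forall>n>n0. error_alpha \<Theta>0 n (K n) \<le> ennreal (exp (- c * real n)) \<and>
            error_beta \<Theta>1 n (K n) \<le> ennreal (exp (- c * real n))"
    by (elim exE conjE)
  then show "distinguishable \<Theta>0 \<Theta>1"
    by (intro distinguishable_if_exponentially_consistent[of K c n0]) simp_all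
qed

end
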